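(* Let $B$ be a unital algebra and $A$ an algebra over $B$. Suppose that a noncommutative probability space $(A,\varphi)$ and a noncommutative probability space $(A,E)$ over $B$ are compatible, and let $x\in A$. Then the scalar-valued R-transform $r_x$ and the scalar-valued moment series $m_x$ of $x$ are given by $$r_x(z)=\sum_{n=1}^\infty\Big(\sum_{\pi\in NC(n)}\Big(\prod_{(v_1,\dots,v_k)\in\pi}\varphi\big(\mathrm{coef}_k(M_x)\big)\Big)\mu(\pi,1_n)\Big)z^n$$ and $$m_x(z)=\sum_{n=1}^\infty\Big(\sum_{\pi\in NC(n)}\ \prod_{(v_1,\dots,v_k)\in\pi}\Big(\sum_{\theta\in NC(k)}\Big(\prod_{(j_1,\dots,j_l)\in\theta}\varphi\big(\mathrm{coef}_l(M_x)\big)\Big)\mu(\theta,1_k)\Big)\Big)z^n.$$ In particular, the scalar-valued moment series of $x$ satisfies $$m_x(z)=r_x\big(z\cdot m_x(z)\big).$$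
   Context: All algebras are over $\mathbb{C}$. A noncommutative probability space $(A,\varphi)$ is a unital algebra $A$ with a linear functional $\varphi:A\to\mathbb{C}$, $\varphi(1)=1$. A noncommutative probability space over $B$ is a pair $(A,E)$ where $1_B=1_A\in B\subset A$ and $E:A\to B$ is a $B$-functional: a linear map with $E(b)=b$ and $E(bab')=bE(a)b'$ for all $b,b'\in B$, $a\in A$. $(A,\varphi)$ and $(A,E)$ are compatible if $\varphi(a)=\varphi(E(a))$ for all $a\in A$. $NC(n)$ is the lattice of noncrossing partitions of $\{1,\dots,n\}$ ordered by refinement, $1_n$ its maximal element, $\mu$ the Möbius function of these lattices. Blocks are written $(v_1,\dots,v_k)$ with $v_1<\dots<v_k$. The scalar-valued cumulants are the multilinear functionals $k_n:A^n\to\mathbb{C}$ determined by $\varphi(a_1\cdots a_n)=\sum_{\pi\in NC(n)}\prod_{(v_1,\dots,v_k)\in\pi}k_k(a_{v_1},\dots,a_{v_k})$. The scalar-valued R-transform and moment series of $x$ are the formal power series $r_x(z)=\sum_{n\ge1}k_n(x,\dots,x)z^n$ and $m_x(z)=\sum_{n\ge1}\varphi(x^n)z^n$. $M_x(z)=\sum_{n\ge1}E(x^n)z^n$ is the (trivial) $B$-valued moment series, so $\mathrm{coef}_n(M_x)=E(x^n)\in B$.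
   Formalization: The final identity is proved as m_x(z) = r_x(z(1 + m_x(z))) instead of m_x(z) = r_x(z·m_x(z)); since m_x has no constant term, the printed form fails, e.g. for A = B = ℂ, φ = E = id, x = 1. *)

theory Defs
  imports
    Complex_Main
    "HOL-Library.Disjoint_Sets"
    "HOL-Computational_Algebra.Formal_Power_Series"
begin

section \<open>Noncrossing partitions and their Moebius function\<close>

definition noncrossing :: "nat set set \<Rightarrow> bool" where
  "noncrossing P \<longleftrightarrow>
     (\<forall>V\<in>P. \<forall>W\<in>P. \<forall>a b c d.
        a < b \<and> b < c \<and> c < d \<and> a \<in> V \<and> c \<in> V \<and> b \<in> W \<and> d \<in> W \<longrightarrow> V = W)"

definition NC :: "nat \<Rightarrow> nat set set set" where
  "NC n = {P. partition_on {1..n} P \<and> noncrossing P}"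

text \<open>The maximal element of \<open>NC n\<close>, for \<open>n \<ge> 1\<close>.\<close>
definition NC_top :: "nat \<Rightarrow> nat set set" where
  "NC_top n = {{1..n}}"

abbreviation NC_le :: "nat \<Rightarrow> nat set set \<Rightarrow> nat set set \<Rightarrow> bool" where
  "NC_le n \<equiv> refines {1..n}"

lemma finite_NC [simp]: "finite (NC n)"
proof -
  have "finite {P. partition_on {1..n} P}"
    by (rule finitely_many_partition_on) simp
  then show ?thesis
    by (rule rev_finite_subset) (auto simp: NC_def)
qed

lemma noncrossing_singleton [simp]: "noncrossing {V}"
  by (auto simp: noncrossing_def)

lemma NC_top_in_NC: "n > 0 \<Longrightarrow> NC_top n \<in> NC n"
  by (auto simp: NC_top_def NC_def partition_on_def)

lemma NC_le_top: "n > 0 \<Longrightarrow> P \<in> NC n \<Longrightarrow> NC_le n P (NC_top n)"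
  by (auto simp: NC_top_def NC_def partition_on_def refines_def)

text \<open>
  The Moebius function of the finite poset \<open>NC n\<close>, by the usual recursion on intervals:
  \<open>\<mu>(\<pi>,\<pi>) = 1\<close>, and \<open>\<Sum>\<^sub>\<tau> \<mu>(\<pi>,\<tau>) = 0\<close> over \<open>\<pi> \<le> \<tau> \<le> \<sigma>\<close> whenever \<open>\<pi> < \<sigma>\<close>.
\<close>
function NC_moebius :: "nat \<Rightarrow> nat set set \<Rightarrow> nat set set \<Rightarrow> int" where
  "NC_moebius n \<pi> \<sigma> =
     (if \<pi> \<notin> NC n \<or> \<sigma> \<notin> NC n \<or> \<not> NC_le n \<pi> \<sigma> then 0
      else if \<pi> = \<sigma> then 1
      else - (\<Sum>\<tau>\<in>{\<tau>\<in>NC n. NC_le n \<pi> \<tau> \<and> NC_le n \<tau> \<sigma> \<and> \<tau> \<noteq> \<sigma>}. NC_moebius n \<pi> \<tau>))"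
  by pat_completeness auto
termination
proof (relation "Wellfounded.measure (\<lambda>(n, \<pi>, \<sigma>). card {\<tau>\<in>NC n. NC_le n \<tau> \<sigma>})", goal_cases)
  case (2 n \<pi> \<sigma> \<tau>)
  have "{\<rho>\<in>NC n. NC_le n \<rho> \<tau>} \<subset> {\<rho>\<in>NC n. NC_le n \<rho> \<sigma>}"
  proof (rule psubsetI)
    show "{\<rho>\<in>NC n. NC_le n \<rho> \<tau>} \<subseteq> {\<rho>\<in>NC n. NC_le n \<rho> \<sigma>}"
      using 2(3) by (auto intro: refines_trans)
    have "\<sigma> \<in> {\<rho>\<in>NC n. NC_le n \<rho> \<sigma>}"
      using 2(1) by (auto simp: NC_def intro: refines_refl)
    moreover have "\<sigma> \<notin> {\<rho>\<in>NC n. NC_le n \<rho> \<tau>}"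
      using 2(3) by (auto dest: refines_asym)
    ultimately show "{\<rho>\<in>NC n. NC_le n \<rho> \<tau>} \<noteq> {\<rho>\<in>NC n. NC_le n \<rho> \<sigma>}"
      by blast
  qed
  then show ?case
    by (simp add: psubset_card_mono)
qed simp

declare NC_moebius.simps [simp del]


section \<open>Noncommutative probability spaces\<close>

text \<open>The type class \<open>ring_1\<close> has \<open>0 \<noteq> 1\<close>; nothing is lost, since \<open>\<phi> 1 = 1\<close> forces this.\<close>
locale complex_algebra = vector_space scale
  for scale :: "complex \<Rightarrow> 'a::ring_1 \<Rightarrow> 'a" +
  assumes scale_mult_left: "scale c a * b = scale c (a * b)"
    and scale_mult_right: "a * scale c b = scale c (a * b)"

locale nc_prob_space = complex_algebra scale
  for scale :: "complex \<Rightarrow> 'a::ring_1 \<Rightarrow> 'a" +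
  fixes \<phi> :: "'a \<Rightarrow> complex"
  assumes linear_functional: "Vector_Spaces.linear scale (*) \<phi>"
    and functional_one: "\<phi> 1 = 1"

text \<open>\<open>E : A \<rightarrow> B\<close> is encoded as a map on \<open>A\<close> with values in the subalgebra \<open>B\<close>.\<close>
locale nc_prob_space_over = complex_algebra scale
  for scale :: "complex \<Rightarrow> 'a::ring_1 \<Rightarrow> 'a" +
  fixes B :: "'a set" and E :: "'a \<Rightarrow> 'a"
  assumes subspace_B: "subspace B"
    and one_in_B: "1 \<in> B"
    and mult_in_B: "b \<in> B \<Longrightarrow> b' \<in> B \<Longrightarrow> b * b' \<in> B"
    and linear_E: "Vector_Spaces.linear scale scale E"
    and E_in_B: "E a \<in> B"
    and E_id: "b \<in> B \<Longrightarrow> E b = b"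
    and E_bimodule: "b \<in> B \<Longrightarrow> b' \<in> B \<Longrightarrow> E (b * a * b') = b * E a * b'"

definition compatible :: "('a \<Rightarrow> complex) \<Rightarrow> ('a \<Rightarrow> 'a) \<Rightarrow> bool" where
  "compatible \<phi> E \<longleftrightarrow> (\<forall>a. \<phi> a = \<phi> (E a))"


section \<open>Scalar-valued cumulants\<close>

text \<open>For \<open>V = {v\<^sub>1 < \<dots> < v\<^sub>k}\<close> this is \<open>(a\<^bsub>v\<^sub>1\<^esub>, \<dots>, a\<^bsub>v\<^sub>k\<^esub>)\<close>; positions count from 1.\<close>
definition subtuple :: "'a list \<Rightarrow> nat set \<Rightarrow> 'a list" where
  "subtuple as V = map (\<lambda>v. as ! (v - 1)) (sorted_list_of_set V)"

lemma length_subtuple [simp]: "length (subtuple as V) = card V"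
  by (simp add: subtuple_def)

lemma NC_block_card_less:
  assumes "P \<in> NC n" "P \<noteq> NC_top n" "V \<in> P"
  shows "card V < n"
proof -
  have part: "partition_on {1..n} P" using assms(1) by (simp add: NC_def)
  have sub: "V \<subseteq> {1..n}" using part assms(3) by (auto simp: partition_on_def)
  have "V \<noteq> {1..n}"
  proof
    assume V: "V = {1..n}"
    have "W = V" if "W \<in> P" for W
    proof (rule ccontr)
      assume "W \<noteq> V"
      then have "W \<inter> V = {}" "W \<noteq> {}" "W \<subseteq> {1..n}"
        using part that assms(3) by (auto simp: partition_on_def disjoint_def)
      then show False using V by auto
    qed
    then have "P = NC_top n" using V assms(3) by (auto simp: NC_top_def)
    then show False using assms(2) by simp
  qed
  then have "V \<subset> {1..n}" using sub by blast
  then have "card V < card {1..n}" by (intro psubset_card_mono) auto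
  then show ?thesis by simp
qed

text \<open>
  \<open>free_cumulant \<phi> [a\<^sub>1, \<dots>, a\<^sub>n]\<close> is \<open>k\<^sub>n(a\<^sub>1, \<dots>, a\<^sub>n)\<close>. The moment-cumulant formula is solved for
  its term at the maximal partition; that this is the unique solution of the formula is
  \<open>moment_cumulant\<close> and \<open>free_cumulant_unique\<close> below.
\<close>
function free_cumulant :: "('a::ring_1 \<Rightarrow> complex) \<Rightarrow> 'a list \<Rightarrow> complex" where
  "free_cumulant \<phi> as =
     \<phi> (prod_list as)
       - (\<Sum>\<pi>\<in>NC (length as) - {NC_top (length as)}. \<Prod>V\<in>\<pi>. free_cumulant \<phi> (subtuple as V))"
  by pat_completeness auto
termination
  by (relation "Wellfounded.measure (\<lambda>(\<phi>, as). length as)")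
     (auto intro: NC_block_card_less)

declare free_cumulant.simps [simp del]

lemma subtuple_all [simp]: "subtuple as {1..length as} = as"
proof -
  have "sorted_list_of_set {1..length as} = [1..<Suc (length as)]"
    by (metis atLeastLessThanSuc_atLeastAtMost sorted_list_of_set_range)
  then show ?thesis
    by (auto simp: subtuple_def intro!: nth_equalityI simp del: upt_Suc)
qed

theorem moment_cumulant:
  assumes "as \<noteq> []"
  shows "\<phi> (prod_list as) = (\<Sum>\<pi>\<in>NC (length as). \<Prod>V\<in>\<pi>. free_cumulant \<phi> (subtuple as V))"
proof -
  have "NC_top (length as) \<in> NC (length as)"
    using assms by (intro NC_top_in_NC) simp
  then have "(\<Sum>\<pi>\<in>NC (length as). \<Prod>V\<in>\<pi>. free_cumulant \<phi> (subtuple as V))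
      = free_cumulant \<phi> as
        + (\<Sum>\<pi>\<in>NC (length as) - {NC_top (length as)}. \<Prod>V\<in>\<pi>. free_cumulant \<phi> (subtuple as V))"
    by (subst sum.remove) (auto simp: NC_top_def simp del: One_nat_def)
  then show ?thesis
    by (simp add: free_cumulant.simps[of \<phi> as])
qed

theorem free_cumulant_unique:
  assumes k: "\<And>as. as \<noteq> [] \<Longrightarrow>
      \<phi> (prod_list as) = (\<Sum>\<pi>\<in>NC (length as). \<Prod>V\<in>\<pi>. k (subtuple as V))"
    and "as \<noteq> []"
  shows "k as = free_cumulant \<phi> as"
  using \<open>as \<noteq> []\<close>
proof (induction "length as" arbitrary: as rule: less_induct)
  case less
  let ?N = "NC (length as)" and ?t = "NC_top (length as)"
  have top: "?t \<in> ?N" using less.prems by (intro NC_top_in_NC) simp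
  have "\<phi> (prod_list as) = k as + (\<Sum>\<pi>\<in>?N - {?t}. \<Prod>V\<in>\<pi>. k (subtuple as V))"
    using k[OF less.prems] top by (subst (asm) sum.remove) (auto simp: NC_top_def simp del: One_nat_def)
  also have "(\<Sum>\<pi>\<in>?N - {?t}. \<Prod>V\<in>\<pi>. k (subtuple as V))
      = (\<Sum>\<pi>\<in>?N - {?t}. \<Prod>V\<in>\<pi>. free_cumulant \<phi> (subtuple as V))"
  proof (intro sum.cong prod.cong refl)
    fix \<pi> V assume \<pi>: "\<pi> \<in> ?N - {?t}" and V: "V \<in> \<pi>"
    have "V \<noteq> {}" "V \<subseteq> {1..length as}"
      using \<pi> V by (auto simp: NC_def partition_on_def)
    then have "card V \<noteq> 0" by (metis card_0_eq finite_atLeastAtMost finite_subset)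
    then have "subtuple as V \<noteq> []" by (metis length_subtuple list.size(3))
    moreover have "length (subtuple as V) < length as"
      using NC_block_card_less \<pi> V by auto
    ultimately show "k (subtuple as V) = free_cumulant \<phi> (subtuple as V)"
      by (intro less.hyps)
  qed
  finally show ?case
    by (simp add: free_cumulant.simps[of \<phi> as])
qed


section \<open>Power series\<close>

text \<open>All three series start at \<open>n = 1\<close>, hence have constant term 0. In the functional equation
  relating them, the series to substitute is therefore \<open>z \<cdot> (1 + m\<^sub>x(z))\<close>; with \<open>z \<cdot> m\<^sub>x(z)\<close> the
  right-hand side would have no linear term, while that of \<open>m\<^sub>x\<close> is \<open>\<phi> x\<close>.\<close>

definition R_transform :: "('a::ring_1 \<Rightarrow> complex) \<Rightarrow> 'a \<Rightarrow> complex fps" where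
  "R_transform \<phi> x = Abs_fps (\<lambda>n. if n = 0 then 0 else free_cumulant \<phi> (replicate n x))"

definition moment_series :: "('a::ring_1 \<Rightarrow> complex) \<Rightarrow> 'a \<Rightarrow> complex fps" where
  "moment_series \<phi> x = Abs_fps (\<lambda>n. if n = 0 then 0 else \<phi> (x ^ n))"

definition B_moment_series :: "('a::ring_1 \<Rightarrow> 'a) \<Rightarrow> 'a \<Rightarrow> 'a fps" where
  "B_moment_series E x = Abs_fps (\<lambda>n. if n = 0 then 0 else E (x ^ n))"

end

theory Submission
  imports Defs "HOL-Library.FuncSet" "HOL-Library.Infinite_Set"
begin

text \<open>
  Compatibility gives \<open>\<phi> (E (x ^ k)) = \<phi> (x ^ k)\<close>, so only scalar moments matter. For a noncrossing
  partition \<open>\<sigma>\<close>, the product of the moments over its blocks is the sum, over all noncrossing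
  \<open>\<pi> \<le> \<sigma>\<close>, of the products of cumulants over the blocks of \<open>\<pi>\<close>: refining \<open>\<sigma>\<close> means choosing a
  noncrossing partition of each block independently. Moebius inversion then expresses cumulants by
  moments, and inserting this into the moment-cumulant formula gives the second identity.

  For the functional equation, weight the block of the least element by a sequence \<open>u\<close> and all
  other blocks by the cumulants \<open>w\<close>, and let \<open>G u\<close> be the resulting generating series and \<open>M\<close>
  the series of moments. Splitting at the maximum of the distinguished block, and deleting that
  maximum, gives \<open>G u = u 1 M + z G (u \<circ> Suc) M\<close>. Iterating this recursion in \<open>M = 1 + z G w\<close>
  yields \<open>M = 1 + \<Sum>\<^sub>k w k (z M)^k\<close>.
\<close>

section \<open>Moebius inversion\<close>

lemma NC_moebius_refl: "\<sigma> \<in> NC n \<Longrightarrow> NC_moebius n \<sigma> \<sigma> = 1"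
  by (simp add: NC_moebius.simps NC_def refines_refl)

lemma sum_NC_moebius_left:
  assumes "\<pi> \<in> NC n" "\<sigma> \<in> NC n" "NC_le n \<pi> \<sigma>"
  shows "(\<Sum>\<tau> | \<tau> \<in> NC n \<and> NC_le n \<pi> \<tau> \<and> NC_le n \<tau> \<sigma>. NC_moebius n \<pi> \<tau>) = (if \<pi> = \<sigma> then 1 else 0)"
proof (cases "\<pi> = \<sigma>")
  case True
  then have "{\<tau>. \<tau> \<in> NC n \<and> NC_le n \<pi> \<tau> \<and> NC_le n \<tau> \<sigma>} = {\<pi>}"
    using assms by (auto dest: refines_asym)
  then show ?thesis
    using True assms by (simp add: NC_moebius_refl)
next
  case False
  have "{\<tau>. \<tau> \<in> NC n \<and> NC_le n \<pi> \<tau> \<and> NC_le n \<tau> \<sigma>}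
      = insert \<sigma> {\<tau> \<in> NC n. NC_le n \<pi> \<tau> \<and> NC_le n \<tau> \<sigma> \<and> \<tau> \<noteq> \<sigma>}"
    using assms by (auto simp: NC_def intro: refines_refl)
  then show ?thesis
    using False assms NC_moebius.simps[of n \<pi> \<sigma>] by simp
qed

text \<open>
  The recursion defining \<open>NC_moebius\<close> makes it a left inverse of the zeta function. It is also a right
  inverse: writing \<open>h = \<zeta> \<mu>\<close>, associativity gives \<open>\<mu> h = \<mu>\<close>, and \<open>\<mu>\<close> is unitriangular.
\<close>
lemma sum_NC_moebius_right:
  assumes "\<pi> \<in> NC n" "\<sigma> \<in> NC n" "NC_le n \<pi> \<sigma>"
  shows "(\<Sum>\<tau> | \<tau> \<in> NC n \<and> NC_le n \<pi> \<tau> \<and> NC_le n \<tau> \<sigma>. NC_moebius n \<tau> \<sigma>) = (if \<pi> = \<sigma> then 1 else 0)"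
  using assms(1,3)
\<comment> \<open>The up-set of \<pi> shrinks as \<pi> moves up, so the claim may be assumed at all
  points strictly between \<pi> and \<sigma>.\<close>
proof (induction "card {\<tau> \<in> NC n. NC_le n \<pi> \<tau>}" arbitrary: \<pi> rule: less_induct)
  case less
  let ?I = "\<lambda>\<pi> \<sigma>. {\<tau>. \<tau> \<in> NC n \<and> NC_le n \<pi> \<tau> \<and> NC_le n \<tau> \<sigma>}"
  let ?h = "\<lambda>\<pi>. \<Sum>\<tau>\<in>?I \<pi> \<sigma>. NC_moebius n \<tau> \<sigma>"
  have fin: "finite (?I \<pi> \<sigma>)" for \<pi> \<sigma>
    by (rule finite_subset[OF _ finite_NC[of n]]) auto
  have refl: "NC_le n \<tau> \<tau>" if "\<tau> \<in> NC n" for \<tau>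
    using that by (simp add: NC_def refines_refl)
  have h_top: "?h \<sigma> = 1"
  proof -
    have "?I \<sigma> \<sigma> = {\<sigma>}" using assms(2) refl by (auto dest: refines_asym)
    then show ?thesis using assms(2) by (simp add: NC_moebius_refl)
  qed
  show ?case
  proof (cases "\<pi> = \<sigma>")
    case True
    then show ?thesis using h_top by simp
  next
    case False
    have h0: "?h \<tau> = 0" if "\<tau> \<in> ?I \<pi> \<sigma>" "\<tau> \<noteq> \<pi>" "\<tau> \<noteq> \<sigma>" for \<tau>
    proof -
      have "\<pi> \<notin> {\<rho> \<in> NC n. NC_le n \<tau> \<rho>}" "\<pi> \<in> {\<rho> \<in> NC n. NC_le n \<pi> \<rho>}"
        using that less.prems refl by (auto dest: refines_asym)
      moreover have "{\<rho> \<in> NC n. NC_le n \<tau> \<rho>} \<subseteq> {\<rho> \<in> NC n. NC_le n \<pi> \<rho>}"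
        using that by (auto intro: refines_trans)
      ultimately have "{\<rho> \<in> NC n. NC_le n \<tau> \<rho>} \<subset> {\<rho> \<in> NC n. NC_le n \<pi> \<rho>}"
        by blast
      then have "card {\<rho> \<in> NC n. NC_le n \<tau> \<rho>} < card {\<rho> \<in> NC n. NC_le n \<pi> \<rho>}"
        by (intro psubset_card_mono) auto
      then show ?thesis
        using less.hyps[of \<tau>] that by simp
    qed
    \<comment> \<open>This sum is evaluated twice. Here, exchanging summations produces inner sums
      over intervals starting at \<pi>, which the left identity collapses to \<rho> = \<pi>.\<close>
    have "(\<Sum>\<tau>\<in>?I \<pi> \<sigma>. NC_moebius n \<pi> \<tau> * ?h \<tau>)
        = (\<Sum>\<tau>\<in>?I \<pi> \<sigma>. \<Sum>\<rho> | \<rho> \<in> ?I \<pi> \<sigma> \<and> NC_le n \<tau> \<rho>. NC_moebius n \<pi> \<tau> * NC_moebius n \<rho> \<sigma>)"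
      unfolding sum_distrib_left by (intro sum.cong refl) (auto intro: refines_trans)
    also have "\<dots> = (\<Sum>\<rho>\<in>?I \<pi> \<sigma>. \<Sum>\<tau> | \<tau> \<in> ?I \<pi> \<sigma> \<and> NC_le n \<tau> \<rho>. NC_moebius n \<pi> \<tau> * NC_moebius n \<rho> \<sigma>)"
      by (rule sum.swap_restrict[OF fin fin])
    also have "\<dots> = (\<Sum>\<rho>\<in>?I \<pi> \<sigma>. (\<Sum>\<tau>\<in>?I \<pi> \<rho>. NC_moebius n \<pi> \<tau>) * NC_moebius n \<rho> \<sigma>)"
      unfolding sum_distrib_right by (intro sum.cong refl) (auto intro: refines_trans)
    also have "\<dots> = (\<Sum>\<rho>\<in>?I \<pi> \<sigma>. if \<pi> = \<rho> then NC_moebius n \<rho> \<sigma> else 0)"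
      using less.prems by (intro sum.cong refl) (auto simp: sum_NC_moebius_left simp del: One_nat_def)
    also have "\<dots> = NC_moebius n \<pi> \<sigma>"
      using less.prems refl fin by simp
    finally have "(\<Sum>\<tau>\<in>?I \<pi> \<sigma>. NC_moebius n \<pi> \<tau> * ?h \<tau>) = NC_moebius n \<pi> \<sigma>" .
    \<comment> \<open>By \<open>h0\<close> only the endpoints survive, leaving
      \<open>?h \<pi> + NC_moebius n \<pi> \<sigma>\<close>; comparing both values forces
      \<open>?h \<pi> = 0\<close>.\<close>
    moreover have "(\<Sum>\<tau>\<in>?I \<pi> \<sigma>. NC_moebius n \<pi> \<tau> * ?h \<tau>)
        = (\<Sum>\<tau>\<in>{\<pi>,\<sigma>}. NC_moebius n \<pi> \<tau> * ?h \<tau>)"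
      using less.prems assms(2) refl fin h0
      by (intro sum.mono_neutral_right) auto
    ultimately show ?thesis
      using False h_top less.prems by (simp add: NC_moebius_refl)
  qed
qed

text \<open>Inserting the formula for \<open>f\<close> and exchanging sums gives
  \<open>g \<pi>\<close> the coefficient obtained by summing
  \<open>NC_moebius n \<sigma> \<rho>\<close> over \<pi> \<le> \<sigma> \<le> \<rho>. The first
  argument varies, so the right inverse property applies.\<close>

lemma NC_moebius_inversion:
  fixes f g :: "nat set set \<Rightarrow> 'a::comm_ring_1"
  assumes f: "\<And>\<sigma>. \<sigma> \<in> NC n \<Longrightarrow> f \<sigma> = (\<Sum>\<pi> | \<pi> \<in> NC n \<and> NC_le n \<pi> \<sigma>. g \<pi>)"
    and \<rho>: "\<rho> \<in> NC n"
  shows "(\<Sum>\<sigma> | \<sigma> \<in> NC n \<and> NC_le n \<sigma> \<rho>. f \<sigma> * of_int (NC_moebius n \<sigma> \<rho>)) = g \<rho>"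
proof -
  let ?D = "{\<sigma>. \<sigma> \<in> NC n \<and> NC_le n \<sigma> \<rho>}"
  have fin: "finite ?D"
    by (rule finite_subset[OF _ finite_NC[of n]]) auto
  have "(\<Sum>\<sigma>\<in>?D. f \<sigma> * of_int (NC_moebius n \<sigma> \<rho>))
      = (\<Sum>\<sigma>\<in>?D. \<Sum>\<pi> | \<pi> \<in> ?D \<and> NC_le n \<pi> \<sigma>. g \<pi> * of_int (NC_moebius n \<sigma> \<rho>))"
    using f unfolding sum_distrib_right[symmetric]
    by (intro sum.cong arg_cong2[of _ _ _ _ "(*)"] refl) (auto intro: refines_trans intro!: sum.cong)
  also have "\<dots> = (\<Sum>\<pi>\<in>?D. \<Sum>\<sigma> | \<sigma> \<in> ?D \<and> NC_le n \<pi> \<sigma>. g \<pi> * of_int (NC_moebius n \<sigma> \<rho>))"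
    by (rule sum.swap_restrict[OF fin fin])
  also have "\<dots> = (\<Sum>\<pi>\<in>?D. g \<pi> * of_int (\<Sum>\<sigma> | \<sigma> \<in> NC n \<and> NC_le n \<pi> \<sigma> \<and> NC_le n \<sigma> \<rho>. NC_moebius n \<sigma> \<rho>))"
    unfolding of_int_sum sum_distrib_left by (intro sum.cong refl) (auto intro: refines_trans)
  also have "\<dots> = (\<Sum>\<pi>\<in>?D. if \<pi> = \<rho> then g \<pi> else 0)"
    using \<rho> by (intro sum.cong refl) (auto simp: sum_NC_moebius_right simp del: of_int_sum One_nat_def)
  also have "\<dots> = g \<rho>"
    using \<rho> fin by (simp add: NC_def refines_refl)
  finally show ?thesis .
qed


section \<open>Weighted sums over noncrossing partitions\<close>

text \<open>Ground sets other than \<open>{1..n}\<close> occur as blocks of a partition and as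
  intervals cut off by a block.\<close>

definition NC_on :: "nat set \<Rightarrow> nat set set set" where
  "NC_on S = {P. partition_on S P \<and> noncrossing P}"

text \<open>For \<open>w\<close> the free cumulants of \<open>x\<close> and
  \<open>S = {1..n}\<close> with n > 0 this is the n-th moment, see
  \<open>moment_eq_NC_sum\<close>.\<close>

definition NC_sum :: "(nat \<Rightarrow> 'a::comm_semiring_1) \<Rightarrow> nat set \<Rightarrow> 'a" where
  "NC_sum w S = (\<Sum>\<pi>\<in>NC_on S. \<Prod>V\<in>\<pi>. w (card V))"

lemma NC_eq_NC_on: "NC n = NC_on {1..n}"
  by (simp add: NC_def NC_on_def)

lemma finite_NC_on: "finite S \<Longrightarrow> finite (NC_on S)"
  by (rule finite_subset[OF _ finitely_many_partition_on]) (auto simp: NC_on_def)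

lemma NC_on_empty: "NC_on {} = {{}}"
  by (auto simp: NC_on_def partition_on_empty noncrossing_def)

lemma NC_onD:
  assumes "\<pi> \<in> NC_on S"
  shows "\<Union>\<pi> = S" "{} \<notin> \<pi>" "disjoint \<pi>" "noncrossing \<pi>" "partition_on S \<pi>"
    and "\<And>V. V \<in> \<pi> \<Longrightarrow> V \<subseteq> S"
  using assms by (auto simp: NC_on_def partition_on_def)

lemma noncrossingD:
  "\<lbrakk>noncrossing P; V \<in> P; W \<in> P; a < b; b < c; c < d; a \<in> V; c \<in> V; b \<in> W; d \<in> W\<rbrakk> \<Longrightarrow> V = W"
  unfolding noncrossing_def by blast

lemma partition_on_blockD:
  "\<lbrakk>partition_on S P; V \<in> P; W \<in> P; a \<in> V; a \<in> W\<rbrakk> \<Longrightarrow> V = W"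
  unfolding partition_on_def disjoint_def by blast

text \<open>Crossings are defined by order alone, and a strictly increasing map reflects the order,
  so a crossing in the image pulls back to one in \<pi>.\<close>

lemma NC_on_image:
  assumes h: "strict_mono_on S h" and "\<pi> \<in> NC_on S"
  shows "(`) h ` \<pi> \<in> NC_on (h ` S)"
proof -
  note P = NC_onD[OF assms(2)]
  have inj: "inj_on h S" using h by (rule strict_mono_on_imp_inj_on)
  have "partition_on (h ` S) ((`) h ` \<pi>)"
    using partition_on_inj_image[OF P(5) inj] P(2) by (simp add: image_iff)
  moreover have "noncrossing ((`) h ` \<pi>)"
    unfolding noncrossing_def
  proof (intro ballI allI impI)
    fix V W a b c d
    assume "V \<in> (`) h ` \<pi>" "W \<in> (`) h ` \<pi>"
      and *: "a < b \<and> b < c \<and> c < d \<and> a \<in> V \<and> c \<in> V \<and> b \<in> W \<and> d \<in> W"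
    then obtain V' W' where V': "V' \<in> \<pi>" "V = h ` V'" and W': "W' \<in> \<pi>" "W = h ` W'" by auto
    with * obtain a' b' c' d' where "a' \<in> V'" "c' \<in> V'" "b' \<in> W'" "d' \<in> W'"
      "a = h a'" "b = h b'" "c = h c'" "d = h d'" by auto
    moreover from this have "a' < b'" "b' < c'" "c' < d'"
      using * P(6)[OF V'(1)] P(6)[OF W'(1)] h by (auto simp: subset_iff strict_mono_on_less)
    ultimately have "V' = W'" using noncrossingD[OF P(4) V'(1) W'(1)] by blast
    then show "V = W" using V' W' by simp
  qed
  ultimately show ?thesis by (simp add: NC_on_def)
qed

lemma NC_sum_image:
  assumes h: "strict_mono_on S h"
  shows "NC_sum w (h ` S) = NC_sum w S"
proof -
  let ?g = "the_inv_into S h"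
  have inj: "inj_on h S" using h by (rule strict_mono_on_imp_inj_on)
  have g: "strict_mono_on (h ` S) ?g"
  proof (rule strict_mono_onI)
    fix r s assume "r \<in> h ` S" "s \<in> h ` S" "r < s"
    then show "?g r < ?g s"
      using inj h by (auto simp: the_inv_into_f_f strict_mono_on_less)
  qed
  have gS: "?g ` h ` S = S"
    using inj by (simp add: the_inv_into_onto)
  have gh: "?g ` h ` V = V" if "V \<subseteq> S" for V
    using that inj by (force simp: the_inv_into_f_f)
  have hg: "h ` ?g ` V = V" if "V \<subseteq> h ` S" for V
    using that inj by (force simp: f_the_inv_into_f)
  have "(\<Sum>\<pi>\<in>NC_on S. \<Prod>V\<in>\<pi>. w (card V)) = (\<Sum>\<pi>\<in>NC_on (h ` S). \<Prod>V\<in>\<pi>. w (card V))"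
  proof (rule sum.reindex_bij_witness[where j = "(`) ((`) h)" and i = "(`) ((`) ?g)"])
    fix \<pi> assume \<pi>: "\<pi> \<in> NC_on S"
    show "(`) ?g ` (`) h ` \<pi> = \<pi>"
      using NC_onD(6)[OF \<pi>] gh by (simp add: image_image)
    show "(`) h ` \<pi> \<in> NC_on (h ` S)" using h \<pi> by (rule NC_on_image)
    have "inj_on ((`) h) \<pi>"
      using NC_onD(6)[OF \<pi>] by (intro inj_on_inverseI[where g = "(`) ?g"]) (simp add: gh)
    then have "(\<Prod>V\<in>(`) h ` \<pi>. w (card V)) = (\<Prod>V\<in>\<pi>. w (card (h ` V)))"
      by (simp add: prod.reindex)
    also have "\<dots> = (\<Prod>V\<in>\<pi>. w (card V))"
      using NC_onD(6)[OF \<pi>] inj by (intro prod.cong refl) (metis card_image inj_on_subset)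
    finally show "(\<Prod>V\<in>(`) h ` \<pi>. w (card V)) = (\<Prod>V\<in>\<pi>. w (card V))" .
  next
    fix \<pi> assume \<pi>: "\<pi> \<in> NC_on (h ` S)"
    show "(`) h ` (`) ?g ` \<pi> = \<pi>"
      using NC_onD(6)[OF \<pi>] hg by (simp add: image_image)
    show "(`) ?g ` \<pi> \<in> NC_on S" using NC_on_image[OF g \<pi>] by (simp only: gS)
  qed
  then show ?thesis by (simp add: NC_sum_def)
qed

text \<open>Both sets are increasing images of the same initial segment of the naturals. Later this
  allows intervals to be shifted freely.\<close>

lemma NC_sum_card_cong:
  assumes "finite S" "finite T" "card S = card T"
  shows "NC_sum w S = NC_sum w T"
proof -
  have *: "NC_sum w U = NC_sum w {..<card U}" if U: "finite U" for U
    by (rule ex_bij_betw_strict_mono_card[OF U]) (metis NC_sum_image bij_betw_imp_surj_on)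
  show ?thesis using *[OF assms(1)] *[OF assms(2)] assms(3) by simp
qed

text \<open>Multiplying out the left side chooses a noncrossing partition \<open>f U\<close> of
  every block \<open>U\<close>; the unions of these choices run exactly once through the refinements
  of \<sigma>. This supplies the hypothesis of Moebius inversion.\<close>

lemma prod_NC_sum:
  fixes w :: "nat \<Rightarrow> 'a::comm_semiring_1"
  assumes \<sigma>: "\<sigma> \<in> NC n"
  shows "(\<Prod>U\<in>\<sigma>. NC_sum w U) = (\<Sum>\<pi> | \<pi> \<in> NC n \<and> NC_le n \<pi> \<sigma>. \<Prod>V\<in>\<pi>. w (card V))"
proof -
  note S = NC_onD[OF \<sigma>[unfolded NC_eq_NC_on]]
  have finU: "finite U" if "U \<in> \<sigma>" for U
    using S(6)[OF that] by (rule finite_subset) simp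
  have fin: "finite \<sigma>"
    using finite_elements[OF _ S(5)] by simp
  have nonempty: "V \<noteq> {}" if "V \<in> f U" "U \<in> \<sigma>" "f \<in> PiE \<sigma> NC_on" for f U V
    using NC_onD(2)[OF PiE_mem[OF that(3,2)]] that(1) by auto
  have sub: "V \<subseteq> U" if "V \<in> f U" "U \<in> \<sigma>" "f \<in> PiE \<sigma> NC_on" for f U V
    using NC_onD(6)[OF PiE_mem[OF that(3,2)] that(1)] .
  \<comment> \<open>A nonempty piece lies in just one block of \<sigma>, which makes the choice
    \<open>f\<close> recoverable from its union.\<close>
  have uniq: "U = U'" if *: "V \<in> f U" "V \<subseteq> U'" "U \<in> \<sigma>" "U' \<in> \<sigma>" "f \<in> PiE \<sigma> NC_on" for f U U' V
  proof -
    obtain v where "v \<in> V" using nonempty[OF *(1,3,5)] by blast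
    then have "v \<in> U" "v \<in> U'" using *(2) sub[OF *(1,3,5)] by blast+
    then show ?thesis by (rule partition_on_blockD[OF S(5) *(3,4)])
  qed
  have "(\<Prod>U\<in>\<sigma>. NC_sum w U) = (\<Sum>f\<in>PiE \<sigma> NC_on. \<Prod>U\<in>\<sigma>. \<Prod>V\<in>f U. w (card V))"
    unfolding NC_sum_def using fin finU by (intro prod_sum_PiE) (auto intro: finite_NC_on)
  also have "\<dots> = (\<Sum>\<pi> | \<pi> \<in> NC n \<and> NC_le n \<pi> \<sigma>. \<Prod>V\<in>\<pi>. w (card V))"
  \<comment> \<open>The inverse collects the pieces inside each block of \<sigma>; restricting it to
    \<sigma> makes it extensional, as \<open>PiE\<close> demands.\<close>
  proof (rule sum.reindex_bij_witness[where
        j = "\<lambda>f. \<Union>(f ` \<sigma>)" and i = "\<lambda>\<pi>. \<lambda>U\<in>\<sigma>. {V \<in> \<pi>. V \<subseteq> U}"])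
    fix f assume f: "f \<in> PiE \<sigma> NC_on"
    have fU: "f U \<in> NC_on U" if "U \<in> \<sigma>" for U using f that by blast
    show "(\<lambda>U\<in>\<sigma>. {V \<in> \<Union>(f ` \<sigma>). V \<subseteq> U}) = f"
    proof (rule extensionalityI[of _ \<sigma>])
      show "f \<in> extensional \<sigma>" using f by (simp add: PiE_def)
      show "(\<lambda>U\<in>\<sigma>. {V \<in> \<Union>(f ` \<sigma>). V \<subseteq> U}) U = f U" if "U \<in> \<sigma>" for U
      proof -
        have "V \<in> f U" if "V \<in> f U'" "V \<subseteq> U" "U' \<in> \<sigma>" for U' V
          using uniq[OF that \<open>U \<in> \<sigma>\<close> f] that by simp
        moreover have "V \<subseteq> U" if "V \<in> f U" for V
          using sub[OF that \<open>U \<in> \<sigma>\<close> f] .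
        ultimately show ?thesis using \<open>U \<in> \<sigma>\<close> by auto
      qed
    qed simp
    have disj: "\<forall>U\<in>\<sigma>. \<forall>U'\<in>\<sigma>. U \<noteq> U' \<longrightarrow> f U \<inter> f U' = {}"
    proof (intro ballI impI, rule ccontr)
      fix U U' assume "U \<in> \<sigma>" "U' \<in> \<sigma>" "U \<noteq> U'" "f U \<inter> f U' \<noteq> {}"
      then obtain V where V: "V \<in> f U" "V \<in> f U'" by blast
      have "V \<subseteq> U'" using sub[OF V(2) \<open>U' \<in> \<sigma>\<close> f] .
      then show False using uniq[OF V(1) _ \<open>U \<in> \<sigma>\<close> \<open>U' \<in> \<sigma>\<close> f] \<open>U \<noteq> U'\<close> by blast
    qed
    have "finite (f U)" if "U \<in> \<sigma>" for U
      using finite_elements[OF finU NC_onD(5)[OF fU]] that by blast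
    then show "(\<Prod>V\<in>\<Union>(f ` \<sigma>). w (card V)) = (\<Prod>U\<in>\<sigma>. \<Prod>V\<in>f U. w (card V))"
      using fin disj by (intro prod.UNION_disjoint) auto
    have part: "partition_on {1..n} (\<Union>(f ` \<sigma>))"
    proof (rule partition_onI)
      have "\<Union>(\<Union>(f ` \<sigma>)) = (\<Union>U\<in>\<sigma>. \<Union>(f U))" by blast
      also have "\<dots> = \<Union>\<sigma>" using NC_onD(1)[OF fU] by simp
      finally show "\<Union>(\<Union>(f ` \<sigma>)) = {1..n}" using S(1) by simp
      show "{} \<notin> \<Union>(f ` \<sigma>)" using nonempty f by blast
      fix p q assume "p \<in> \<Union>(f ` \<sigma>)" "q \<in> \<Union>(f ` \<sigma>)" "p \<noteq> q"
      then obtain U U' where U: "U \<in> \<sigma>" "p \<in> f U" and U': "U' \<in> \<sigma>" "q \<in> f U'" by blast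
      show "disjnt p q"
      proof (rule ccontr)
        assume "\<not> disjnt p q"
        then obtain v where v: "v \<in> p" "v \<in> q" by (auto simp: disjnt_def)
        then have "U = U'"
          using sub[OF U(2,1) f] sub[OF U'(2,1) f] partition_on_blockD[OF S(5) U(1) U'(1), of v] by blast
        then show False
          using partition_on_blockD[OF NC_onD(5)[OF fU[OF U(1)]] U(2) _ v] U' \<open>p \<noteq> q\<close> by blast
      qed
    qed
    \<comment> \<open>Crossing pieces of two different blocks would make those blocks of \<sigma>
      cross; within one block \<open>U\<close> the partition \<open>f U\<close> is
      noncrossing.\<close>
    moreover have "noncrossing (\<Union>(f ` \<sigma>))"
      unfolding noncrossing_def
    proof (intro ballI allI impI)
      fix V W a b c d
      assume "V \<in> \<Union>(f ` \<sigma>)" "W \<in> \<Union>(f ` \<sigma>)"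
        and *: "a < b \<and> b < c \<and> c < d \<and> a \<in> V \<and> c \<in> V \<and> b \<in> W \<and> d \<in> W"
      then obtain U U' where U: "U \<in> \<sigma>" "V \<in> f U" and U': "U' \<in> \<sigma>" "W \<in> f U'" by blast
      have "U = U'"
        using noncrossingD[OF S(4) U(1) U'(1), of a b c d] * sub[OF U(2,1) f] sub[OF U'(2,1) f] by blast
      then show "V = W"
        using noncrossingD[OF NC_onD(4)[OF fU[OF U(1)]] U(2), of W a b c d] U' * by blast
    qed
    moreover have "\<exists>Y\<in>\<sigma>. V \<subseteq> Y" if "V \<in> \<Union>(f ` \<sigma>)" for V
      using that sub[OF _ _ f] by blast
    ultimately show "\<Union>(f ` \<sigma>) \<in> {\<pi>. \<pi> \<in> NC n \<and> NC_le n \<pi> \<sigma>}"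
      using S(5) by (simp add: NC_def refines_def)
  next
    fix \<pi> assume \<pi>: "\<pi> \<in> {\<pi>. \<pi> \<in> NC n \<and> NC_le n \<pi> \<sigma>}"
    then have "\<forall>V\<in>\<pi>. \<exists>U\<in>\<sigma>. V \<subseteq> U"
      by (simp add: refines_def)
    then show "\<Union>((\<lambda>U\<in>\<sigma>. {V \<in> \<pi>. V \<subseteq> U}) ` \<sigma>) = \<pi>"
      by force
    have "{V \<in> \<pi>. V \<subseteq> U} \<in> NC_on U" if "U \<in> \<sigma>" for U
      using refines_obtains_subset[of "{1..n}" \<pi> \<sigma> U] that \<pi>
      by (auto simp: NC_on_def NC_def noncrossing_def)
    then show "(\<lambda>U\<in>\<sigma>. {V \<in> \<pi>. V \<subseteq> U}) \<in> PiE \<sigma> NC_on" by auto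
  qed
  finally show ?thesis .
qed


section \<open>Splitting at the block of the least element\<close>

text \<open>The block of 0, called the root, is kept apart because it gets its own weight. Counting
  from 0, the index n stands for n + 1 points, which later costs a factor
  \<open>fps_X\<close>.\<close>

definition rooted_NC :: "nat \<Rightarrow> (nat set \<times> nat set set) set" where
  "rooted_NC n = {(V, Q). 0 \<in> V \<and> V \<notin> Q \<and> insert V Q \<in> NC_on {..n}}"

text \<open>Deleting a point of the root shifts its weight from \<open>u\<close> to
  \<open>u \<circ> Suc\<close> while the other blocks keep \<open>w\<close>; hence two weight
  sequences.\<close>

definition rooted_NC_sum :: "(nat \<Rightarrow> 'a) \<Rightarrow> (nat \<Rightarrow> 'a::comm_semiring_1) \<Rightarrow> nat \<Rightarrow> 'a" where
  "rooted_NC_sum u w n = (\<Sum>(V, Q)\<in>rooted_NC n. u (card V) * (\<Prod>W\<in>Q. w (card W)))"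

text \<open>This form is the one checked when partitions are cut and joined. If \<open>V\<close>
  meets a block of \<open>Q\<close>, both sides fail: the left because that block would equal
  \<open>V\<close>, the right because \<open>Q\<close> avoids \<open>V\<close>.\<close>

lemma rooted_NC_iff:
  "(V, Q) \<in> rooted_NC n \<longleftrightarrow>
    0 \<in> V \<and> V \<subseteq> {..n} \<and> partition_on ({..n} - V) Q \<and> noncrossing (insert V Q)"
proof (cases "disjnt V (\<Union>Q)")
  case True
  have "V \<notin> Q" if "0 \<in> V" using True that by (auto simp: disjnt_def)
  moreover have "V \<noteq> {}" if "0 \<in> V" using that by blast
  ultimately show ?thesis
    using partition_on_insert[OF True, of "{..n}"] by (auto simp only: rooted_NC_def NC_on_def mem_Collect_eq prod.case)
next
  case False
  then obtain x W where "x \<in> V" "W \<in> Q" "x \<in> W" by (auto simp: disjnt_def)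
  then have "V \<in> Q" if "partition_on {..n} (insert V Q)"
    using partition_on_blockD[OF that, of V W x] by simp
  moreover have "\<not> partition_on ({..n} - V) Q"
    using \<open>x \<in> V\<close> \<open>W \<in> Q\<close> \<open>x \<in> W\<close> partition_onD1 by fastforce
  ultimately show ?thesis by (simp add: rooted_NC_def NC_on_def)
qed

lemma finite_rooted_NC: "finite (rooted_NC n)"
proof (rule finite_subset)
  show "rooted_NC n \<subseteq> Pow {..n} \<times> Pow (Pow {..n})"
    by (auto simp: rooted_NC_def NC_on_def partition_on_def)
qed simp

lemma NC_sum_atMost: "NC_sum w {..n} = rooted_NC_sum w w n"
proof -
  let ?root = "\<lambda>\<pi>. THE V. V \<in> \<pi> \<and> 0 \<in> V"
  have root: "?root \<pi> = V" if "\<pi> \<in> NC_on {..n}" "V \<in> \<pi>" "0 \<in> V" for \<pi> V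
    by (rule the_equality) (use that partition_on_blockD[OF NC_onD(5)[OF that(1)] that(2)] in auto)
  show ?thesis
    unfolding NC_sum_def rooted_NC_sum_def
  proof (rule sum.reindex_bij_witness[where
        i = "\<lambda>(V, Q). insert V Q" and j = "\<lambda>\<pi>. (?root \<pi>, \<pi> - {?root \<pi>})"])
    fix \<pi> assume \<pi>: "\<pi> \<in> NC_on {..n}"
    obtain V where V: "V \<in> \<pi>" "0 \<in> V"
      using NC_onD(1)[OF \<pi>] by (metis UnionE atMost_iff le0)
    have [simp]: "?root \<pi> = V" using \<pi> V by (rule root)
    show "(case (?root \<pi>, \<pi> - {?root \<pi>}) of (V, Q) \<Rightarrow> insert V Q) = \<pi>"
      using V by auto
    show "(?root \<pi>, \<pi> - {?root \<pi>}) \<in> rooted_NC n"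
      using V \<pi> by (simp add: rooted_NC_def insert_absorb)
    have "finite \<pi>"
      using finite_elements[OF _ NC_onD(5)[OF \<pi>]] by simp
    then show "(case (?root \<pi>, \<pi> - {?root \<pi>}) of (V, Q) \<Rightarrow> w (card V) * (\<Prod>W\<in>Q. w (card W)))
        = (\<Prod>W\<in>\<pi>. w (card W))"
      using V by (simp add: prod.remove)
  next
    fix b assume "b \<in> rooted_NC n"
    then obtain V Q where b: "b = (V, Q)" "0 \<in> V" "V \<notin> Q" "insert V Q \<in> NC_on {..n}"
      by (auto simp: rooted_NC_def)
    have V: "?root (insert V Q) = V" using b(4) _ b(2) by (rule root) simp
    show "(?root (case b of (V, Q) \<Rightarrow> insert V Q),
        (case b of (V, Q) \<Rightarrow> insert V Q) - {?root (case b of (V, Q) \<Rightarrow> insert V Q)}) = b"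
      unfolding b(1) prod.case V using b(3) by simp
    show "(case b of (V, Q) \<Rightarrow> insert V Q) \<in> NC_on {..n}"
      using b by simp
  qed
qed

text \<open>The new root element \<open>Suc j\<close> exceeds all points of the left part and
  precedes all points of \<open>Q'\<close>, so any crossing would already be present in one of the
  two parts.\<close>

lemma rooted_NC_join:
  assumes "(V, Q) \<in> rooted_NC j" "Q' \<in> NC_on {Suc (Suc j)..n}" "j < n"
  shows "(insert (Suc j) V, Q \<union> Q') \<in> rooted_NC n"
proof -
  have V: "0 \<in> V" "V \<subseteq> {..j}" and Q: "partition_on ({..j} - V) Q" and nc: "noncrossing (insert V Q)"
    using assms(1) by (auto simp: rooted_NC_iff)
  note Q' = NC_onD[OF assms(2)]
  have Qs: "W \<subseteq> {..j} - V" if "W \<in> Q" for W using Q that by (auto simp: partition_on_def)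
  have Q's: "W \<subseteq> {Suc (Suc j)..n}" if "W \<in> Q'" for W using Q'(6) that by blast
  have "partition_on ({..n} - insert (Suc j) V) (Q \<union> Q')"
  proof -
    have "{..n} - insert (Suc j) V = ({..j} - V) \<union> {Suc (Suc j)..n}"
      using V assms(3) by (auto simp: not_less_eq_eq)
    moreover have "disjoint (Q \<union> Q')"
      using Q Q'(5) by (intro disjoint_union) (auto simp: partition_on_def)
    ultimately show ?thesis
      using Q Q'(5) by (auto simp: partition_on_def)
  qed
  moreover have "noncrossing (insert (insert (Suc j) V) (Q \<union> Q'))"
    unfolding noncrossing_def
  proof (intro ballI allI impI)
    fix A B a b c d
    assume A: "A \<in> insert (insert (Suc j) V) (Q \<union> Q')" and B: "B \<in> insert (insert (Suc j) V) (Q \<union> Q')"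
      and "a < b \<and> b < c \<and> c < d \<and> a \<in> A \<and> c \<in> A \<and> b \<in> B \<and> d \<in> B"
    then have *: "a < b" "b < c" "c < d" "a \<in> A" "c \<in> A" "b \<in> B" "d \<in> B" by auto
    have low: "x \<le> Suc j" if "x \<in> X" "X \<in> insert (insert (Suc j) V) Q" for x X
      using that V(2) Qs by fastforce
    have high: "Suc j < x" if "x \<in> X" "X \<in> Q'" for x X
      using Q's that by fastforce
    consider "A \<in> Q'" "B \<in> Q'" | "A \<in> Q" "B \<in> Q" | "A = insert (Suc j) V" "B = insert (Suc j) V"
      | "A = insert (Suc j) V" "B \<in> Q" | "A \<in> Q" "B = insert (Suc j) V"
      | "A \<in> Q'" "B \<in> insert (insert (Suc j) V) Q" | "A \<in> insert (insert (Suc j) V) Q" "B \<in> Q'"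
      using A B by auto
    then show "A = B"
    proof cases
      case 1
      then show ?thesis using noncrossingD[OF Q'(4) _ _ *(1-3)] * by blast
    next
      case 2
      then show ?thesis using noncrossingD[OF nc _ _ *(1-3)] * by blast
    next
      case 4
      \<comment> \<open>As \<open>c < d \<le> j\<close>, the new point is not involved and the
        crossing is an old one.\<close>
      then have "d \<le> j" using Qs *(7) by auto
      then have "a \<in> V" "c \<in> V" using 4 * by auto
      then have "V = B" using noncrossingD[OF nc _ _ *(1-3)] 4 * by blast
      then show ?thesis using Qs[OF 4(2)] V(1) by auto
    next
      case 5
      then have "c \<le> j" "a \<notin> V" using Qs *(4,5) by auto
      \<comment> \<open>Here \<open>d\<close> may be the new point \<open>Suc j\<close>. The root
        element 0 replaces it: 0 < a < b < c is a crossing of the old partition.\<close>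
      then have "b \<in> V" "0 < a" using 5 * V(1) by (auto intro: gr0I)
      then have "V = A" using noncrossingD[OF nc _ _ _ *(1,2)] 5 * V(1) by blast
      then show ?thesis using Qs[OF 5(1)] V(1) by auto
    next
      case 6
      then have "b \<le> Suc j" "Suc j < a" using low[OF *(6)] high[OF *(4)] by auto
      then show ?thesis using *(1) by simp
    next
      case 7
      then have "c \<le> Suc j" "Suc j < b" using low[OF *(5)] high[OF *(6)] by auto
      then show ?thesis using *(2) by simp
    qed simp
  qed
  ultimately show ?thesis
    using V assms(3) by (auto simp: rooted_NC_iff)
qed

text \<open>Both 0 and \<open>Max V\<close> lie in the root, so a block with points on either side
  of \<open>Max V\<close> would cross it. Hence every other block lies entirely to the left or
  entirely to the right.\<close>

lemma rooted_NC_split: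
  assumes VQ: "(V, Q) \<in> rooted_NC n" and "V \<noteq> {0}"
  obtains j where "j < n" "Max V = Suc j"
    "(V - {Suc j}, {W \<in> Q. W \<subseteq> {..j}}) \<in> rooted_NC j"
    "{W \<in> Q. W \<subseteq> {Suc (Suc j)..n}} \<in> NC_on {Suc (Suc j)..n}"
    "{W \<in> Q. W \<subseteq> {..j}} \<union> {W \<in> Q. W \<subseteq> {Suc (Suc j)..n}} = Q"
proof -
  have V: "0 \<in> V" "V \<subseteq> {..n}" and Q: "partition_on ({..n} - V) Q" and nc: "noncrossing (insert V Q)"
    using VQ by (auto simp: rooted_NC_iff)
  have finV: "finite V" using V(2) by (rule finite_subset) simp
  have Qs: "W \<subseteq> {..n} - V" if "W \<in> Q" for W using Q that by (auto simp: partition_on_def)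
  obtain v where "v \<in> V" "v \<noteq> 0" using V(1) assms(2) by blast
  then have "Max V \<noteq> 0" using Max_ge[OF finV, of v] by auto
  then obtain j where j: "Max V = Suc j" using not0_implies_Suc by blast
  have jV: "Suc j \<in> V" using Max_in[OF finV] V(1) j by auto
  then have jn: "j < n" using V(2) by auto
  have Vj: "x \<le> Suc j" if "x \<in> V" for x using Max_ge[OF finV that] j by simp
  let ?Q1 = "{W \<in> Q. W \<subseteq> {..j}}" and ?Q2 = "{W \<in> Q. W \<subseteq> {Suc (Suc j)..n}}"
  have split: "?Q1 \<union> ?Q2 = Q"
  proof -
    have "W \<subseteq> {..j} \<or> W \<subseteq> {Suc (Suc j)..n}" if W: "W \<in> Q" for W
    proof (rule ccontr)
      assume "\<not> ?thesis"
      then obtain a b where ab: "a \<in> W" "\<not> a \<le> j" "b \<in> W" "\<not> (Suc (Suc j) \<le> b \<and> b \<le> n)"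
        by (meson atLeastAtMost_iff atMost_iff subsetI)
      have "0 \<notin> W" "Suc j \<notin> W" "b \<le> n" using Qs[OF W] V(1) jV ab(3) by auto
      then have "a \<noteq> Suc j" "b \<noteq> Suc j" "b \<noteq> 0" using ab(1,3) by metis+
      then have "0 < b" "b < Suc j" "Suc j < a" using ab(2,4) \<open>b \<le> n\<close> by auto
      then have "V = W" using noncrossingD[OF nc, of V W 0 b "Suc j" a] W ab(1,3) V(1) jV by blast
      then show False using \<open>0 \<notin> W\<close> V(1) by simp
    qed
    then show ?thesis by blast
  qed
  have disj: "X = Y" if "X \<in> Q" "Y \<in> Q" "x \<in> X" "x \<in> Y" for X Y x
    using partition_on_blockD[OF Q that] .
  have cover: "\<exists>W\<in>Q. x \<in> W" if "x \<le> n" "x \<notin> V" for x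
    using Q that by (auto simp: partition_on_def)
  have Q1: "partition_on ({..j} - (V - {Suc j})) ?Q1"
  proof (rule partition_onI)
    show "\<Union>?Q1 = {..j} - (V - {Suc j})"
    proof (intro equalityI subsetI)
      fix x assume "x \<in> \<Union>?Q1"
      then show "x \<in> {..j} - (V - {Suc j})" using Qs by blast
    next
      fix x assume "x \<in> {..j} - (V - {Suc j})"
      then have x: "x \<le> j" "x \<notin> V" by auto
      then obtain W where W: "W \<in> Q" "x \<in> W" using cover[of x] jn by auto
      moreover have "W \<notin> ?Q2" using W x by auto
      ultimately show "x \<in> \<Union>?Q1" using split by blast
    qed
  qed (use Q in \<open>auto simp: partition_on_def disjoint_def disjnt_def\<close>)
  have Q2: "partition_on {Suc (Suc j)..n} ?Q2"
  proof (rule partition_onI)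
    show "\<Union>?Q2 = {Suc (Suc j)..n}"
    proof (intro equalityI subsetI)
      fix x assume x: "x \<in> {Suc (Suc j)..n}"
      then have "x \<notin> V" using Vj[of x] by auto
      then obtain W where W: "W \<in> Q" "x \<in> W" using cover[of x] x by auto
      moreover have "W \<notin> ?Q1" using W x by auto
      ultimately show "x \<in> \<Union>?Q2" using split by blast
    qed blast
  qed (use Q in \<open>auto simp: partition_on_def disjoint_def disjnt_def\<close>)
  have nc2: "noncrossing ?Q2"
    using nc by (auto simp: noncrossing_def)
  \<comment> \<open>A crossing with the shortened root is also one with \<open>V\<close>, and
    \<open>V\<close> is not among the blocks in \<open>Q\<close>.\<close>
  have nc1: "noncrossing (insert (V - {Suc j}) ?Q1)"
    unfolding noncrossing_def
  proof (intro ballI allI impI)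
    fix A B a b c d
    assume A: "A \<in> insert (V - {Suc j}) ?Q1" and B: "B \<in> insert (V - {Suc j}) ?Q1"
      and *: "a < b \<and> b < c \<and> c < d \<and> a \<in> A \<and> c \<in> A \<and> b \<in> B \<and> d \<in> B"
    have VW: "W \<noteq> V" if "W \<in> Q" for W using Qs[OF that] V(1) by blast
    consider "A \<in> Q" "B \<in> Q" | "A = V - {Suc j}" "B = V - {Suc j}"
      | "A = V - {Suc j}" "B \<in> Q" | "A \<in> Q" "B = V - {Suc j}"
      using A B by blast
    then show "A = B"
    proof cases
      case 1
      then show ?thesis using noncrossingD[OF nc, of A B a b c d] * by blast
    next
      case 3
      then show ?thesis using noncrossingD[OF nc, of V B a b c d] * VW by blast
    next
      case 4
      then show ?thesis using noncrossingD[OF nc, of A V a b c d] * VW by blast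
    qed simp
  qed
  have "V - {Suc j} \<subseteq> {..j}" using Vj by (fastforce simp: le_Suc_eq)
  then have "(V - {Suc j}, ?Q1) \<in> rooted_NC j"
    using V(1) Q1 nc1 by (simp add: rooted_NC_iff)
  moreover have "?Q2 \<in> NC_on {Suc (Suc j)..n}"
    using Q2 nc2 by (simp add: NC_on_def)
  ultimately show ?thesis using that jn j split by blast
qed

text \<open>A crossing takes two points from each of its blocks. This handles the root
  \<open>{0}\<close> in the recursion below.\<close>

lemma noncrossing_insert_singleton: "noncrossing (insert {v} \<pi>) \<longleftrightarrow> noncrossing \<pi>"
proof
  assume \<pi>: "noncrossing (insert {v} \<pi>)"
  show "noncrossing \<pi>"
    unfolding noncrossing_def
  proof (intro ballI allI impI)
    fix V W a b c d
    assume "V \<in> \<pi>" "W \<in> \<pi>" "a < b \<and> b < c \<and> c < d \<and> a \<in> V \<and> c \<in> V \<and> b \<in> W \<and> d \<in> W"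
    then show "V = W" using noncrossingD[OF \<pi>, of V W a b c d] by simp
  qed
next
  assume \<pi>: "noncrossing \<pi>"
  show "noncrossing (insert {v} \<pi>)"
    unfolding noncrossing_def
  proof (intro ballI allI impI)
    fix V W a b c d
    assume VW: "V \<in> insert {v} \<pi>" "W \<in> insert {v} \<pi>"
      and *: "a < b \<and> b < c \<and> c < d \<and> a \<in> V \<and> c \<in> V \<and> b \<in> W \<and> d \<in> W"
    then have "V \<noteq> {v}" "W \<noteq> {v}" by auto
    then show "V = W" using noncrossingD[OF \<pi>, of V W a b c d] VW * by blast
  qed
qed

text \<open>The first term collects the roots \<open>{0}\<close>; the others are cut at their
  maximum \<open>Suc j\<close>, whose deletion leaves a root one element smaller and an independent
  partition of the points beyond.\<close>

lemma rooted_NC_sum_rec: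
  "rooted_NC_sum u w n = u 1 * NC_sum w {1..n}
    + (\<Sum>j<n. rooted_NC_sum (\<lambda>k. u (Suc k)) w j * NC_sum w {Suc (Suc j)..n})"
proof -
  let ?t = "\<lambda>(V, Q). u (card V) * (\<Prod>W\<in>Q. w (card W))"
  let ?A = "{b \<in> rooted_NC n. fst b = {0}}" and ?B = "{b \<in> rooted_NC n. fst b \<noteq> {0}}"
  \<comment> \<open>On \<open>?B\<close> the maximum of the root is positive, so
    \<open>Max V - 1\<close> is a true predecessor.\<close>
  let ?j = "\<lambda>(V, Q). (Max V - 1, (V - {Max V}, {W \<in> Q. W \<subseteq> {..Max V - 1}}), {W \<in> Q. W \<subseteq> {Suc (Max V)..n}})"
  let ?i = "\<lambda>(j, (V, Q), Q'). (insert (Suc j) V, Q \<union> Q')"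
  let ?s = "\<lambda>(j, (V, Q), Q'). u (Suc (card V)) * (\<Prod>W\<in>Q. w (card W)) * (\<Prod>W\<in>Q'. w (card W))"
  let ?S = "SIGMA j:{..<n}. rooted_NC j \<times> NC_on {Suc (Suc j)..n}"
  have "rooted_NC_sum u w n = sum ?t ?A + sum ?t ?B"
    unfolding rooted_NC_sum_def
    by (subst sum.union_disjoint[symmetric]) (auto intro!: sum.cong simp: finite_rooted_NC)
  moreover have "sum ?t ?A = u 1 * NC_sum w {1..n}"
  proof -
    have "sum ?t ?A = (\<Sum>\<pi>\<in>NC_on {1..n}. u 1 * (\<Prod>V\<in>\<pi>. w (card V)))"
    proof (rule sum.reindex_bij_witness[where i = "\<lambda>\<pi>. ({0}, \<pi>)" and j = snd])
      have *: "({0}, \<pi>) \<in> rooted_NC n \<longleftrightarrow> \<pi> \<in> NC_on {1..n}" for \<pi>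
      proof -
        have "{..n} - {0} = {1..n}" by auto
        then show ?thesis by (simp only: rooted_NC_iff NC_on_def noncrossing_insert_singleton) simp
      qed
      show "snd b \<in> NC_on {1..n}" if "b \<in> ?A" for b
        using that by (cases b) (auto simp only: * fst_conv snd_conv mem_Collect_eq)
      show "({0}, \<pi>) \<in> ?A" if "\<pi> \<in> NC_on {1..n}" for \<pi>
        using that by (simp only: * fst_conv mem_Collect_eq)
      show "({0}, snd b) = b" if "b \<in> ?A" for b
        using that by (cases b) simp
      show "u 1 * (\<Prod>V\<in>snd b. w (card V)) = ?t b" if "b \<in> ?A" for b
        using that by (cases b) simp
    qed simp
    then show ?thesis by (simp add: NC_sum_def sum_distrib_left)
  qed
  moreover have "sum ?t ?B = sum ?s ?S"
  proof (rule sum.reindex_bij_witness[where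
        j = ?j and i = ?i])
    fix b assume "b \<in> ?B"
    then obtain V Q where b: "b = (V, Q)" "(V, Q) \<in> rooted_NC n" "V \<noteq> {0}" by (cases b) auto
    obtain j where j: "j < n" "Max V = Suc j"
      "(V - {Suc j}, {W \<in> Q. W \<subseteq> {..j}}) \<in> rooted_NC j"
      "{W \<in> Q. W \<subseteq> {Suc (Suc j)..n}} \<in> NC_on {Suc (Suc j)..n}"
      "{W \<in> Q. W \<subseteq> {..j}} \<union> {W \<in> Q. W \<subseteq> {Suc (Suc j)..n}} = Q"
      using rooted_NC_split[OF b(2,3)] .
    have V: "0 \<in> V" "V \<subseteq> {..n}" using b(2) by (auto simp: rooted_NC_iff)
    have finV: "finite V" using V(2) by (rule finite_subset) simp
    have jV: "Suc j \<in> V" using Max_in[OF finV] V(1) j(2) by auto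
    have jb: "?j b = (j, (V - {Suc j}, {W \<in> Q. W \<subseteq> {..j}}), {W \<in> Q. W \<subseteq> {Suc (Suc j)..n}})"
      by (simp add: b(1) j(2))
    show "?i (?j b) = b"
      unfolding jb using jV j(5) by (simp add: b(1) insert_absorb)
    show "?j b \<in> ?S" unfolding jb using j by simp
    have "partition_on ({..n} - V) Q" using b(2) by (simp add: rooted_NC_iff)
    then have fin: "finite Q" and ne: "{} \<notin> Q"
      using finite_elements[of "{..n} - V" Q] by (auto simp: partition_on_def)
    \<comment> \<open>Only the empty set is contained in both sides of the cut; blocks are nonempty,
      so the two families are disjoint and the product factors.\<close>
    have "{..j} \<inter> {Suc (Suc j)..n} = {}" by auto
    then have "W = {}" if "W \<subseteq> {..j}" "W \<subseteq> {Suc (Suc j)..n}" for W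
      using that by blast
    then have "{W \<in> Q. W \<subseteq> {..j}} \<inter> {W \<in> Q. W \<subseteq> {Suc (Suc j)..n}} = {}"
      using ne by auto
    then have "(\<Prod>W\<in>Q. w (card W))
        = (\<Prod>W | W \<in> Q \<and> W \<subseteq> {..j}. w (card W)) * (\<Prod>W | W \<in> Q \<and> W \<subseteq> {Suc (Suc j)..n}. w (card W))"
      using fin by (subst j(5)[symmetric], intro prod.union_disjoint) auto
    moreover have "card V = Suc (card (V - {Suc j}))"
      using finV jV by (metis card_Suc_Diff1)
    ultimately show "?s (?j b) = ?t b"
      unfolding jb by (simp add: b(1) mult.assoc)
  next
    fix s assume "s \<in> ?S"
    then obtain j V Q Q' where s: "s = (j, (V, Q), Q')" "j < n" "(V, Q) \<in> rooted_NC j"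
      "Q' \<in> NC_on {Suc (Suc j)..n}" by auto
    have V: "0 \<in> V" "V \<subseteq> {..j}" and Q: "partition_on ({..j} - V) Q"
      using s(3) by (auto simp: rooted_NC_iff)
    have Qs: "W \<subseteq> {..j} \<and> W \<noteq> {}" if "W \<in> Q" for W using Q that by (auto simp: partition_on_def)
    have Q's: "W \<subseteq> {Suc (Suc j)..n} \<and> W \<noteq> {}" if "W \<in> Q'" for W
      using NC_onD(2,6)[OF s(4)] that by blast
    have "{..j} \<inter> {Suc (Suc j)..n} = {}" by auto
    then have excl: "W = {}" if "W \<subseteq> {..j}" "W \<subseteq> {Suc (Suc j)..n}" for W
      using that by blast
    have "finite V" using V(2) by (rule finite_subset) simp
    then have "Max (insert (Suc j) V) = Suc j"
      using V by (intro Max_eqI) auto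
    moreover have "insert (Suc j) V - {Suc j} = V" using V(2) by auto
    moreover have "{W \<in> Q \<union> Q'. W \<subseteq> {..j}} = Q" "{W \<in> Q \<union> Q'. W \<subseteq> {Suc (Suc j)..n}} = Q'"
    proof -
      have "W \<subseteq> {..j} \<and> \<not> W \<subseteq> {Suc (Suc j)..n}" if "W \<in> Q" for W
        using Qs[OF that] excl by blast
      moreover have "\<not> W \<subseteq> {..j} \<and> W \<subseteq> {Suc (Suc j)..n}" if "W \<in> Q'" for W
        using Q's[OF that] excl by blast
      ultimately show "{W \<in> Q \<union> Q'. W \<subseteq> {..j}} = Q" "{W \<in> Q \<union> Q'. W \<subseteq> {Suc (Suc j)..n}} = Q'"
        by blast+
    qed
    ultimately show "?j (?i s) = s"
      by (simp add: s(1))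
    show "?i s \<in> ?B"
      using rooted_NC_join[OF s(3,4,2)] by (auto simp: s(1))
  qed
  moreover have "sum ?s ?S
      = (\<Sum>j<n. \<Sum>((V, Q), Q')\<in>rooted_NC j \<times> NC_on {Suc (Suc j)..n}.
          u (Suc (card V)) * (\<Prod>W\<in>Q. w (card W)) * (\<Prod>W\<in>Q'. w (card W)))"
    by (subst sum.Sigma) (auto simp: finite_rooted_NC finite_NC_on intro!: sum.cong)
  moreover have "\<dots> = (\<Sum>j<n. rooted_NC_sum (\<lambda>k. u (Suc k)) w j * NC_sum w {Suc (Suc j)..n})"
    unfolding rooted_NC_sum_def NC_sum_def sum_product sum.cartesian_product
    by (intro sum.cong refl) auto
  ultimately show ?thesis by simp
qed

section \<open>The functional equation\<close>

text \<open>The empty set contributes the constant coefficient 1; with cumulants of \<open>x\<close>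
  as weights this is \<open>1 + moment_series \<phi> x\<close>.\<close>

definition NC_sum_fps :: "(nat \<Rightarrow> 'a::comm_semiring_1) \<Rightarrow> 'a fps" where
  "NC_sum_fps w = Abs_fps (\<lambda>n. NC_sum w {1..n})"

lemma rooted_NC_sum_fps_rec:
  fixes u w :: "nat \<Rightarrow> 'a::comm_ring_1"
  shows "Abs_fps (rooted_NC_sum u w) = fps_const (u 1) * NC_sum_fps w
    + fps_X * (Abs_fps (rooted_NC_sum (\<lambda>k. u (Suc k)) w) * NC_sum_fps w)"
proof (rule fps_ext)
  fix n
  let ?G = "Abs_fps (rooted_NC_sum (\<lambda>k. u (Suc k)) w)"
  \<comment> \<open>The interval beyond the cut has n - 1 - j points; replacing it by
    \<open>{1..n - 1 - j}\<close> exhibits a Cauchy product, delayed by one power of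
    \<open>fps_X\<close>.\<close>
  have "(\<Sum>j<n. rooted_NC_sum (\<lambda>k. u (Suc k)) w j * NC_sum w {Suc (Suc j)..n})
      = (\<Sum>j<n. rooted_NC_sum (\<lambda>k. u (Suc k)) w j * NC_sum w {1..n - 1 - j})"
    by (intro sum.cong arg_cong2[of _ _ _ _ "(*)"] NC_sum_card_cong refl) auto
  also have "\<dots> = fps_nth (fps_X * (?G * NC_sum_fps w)) n"
  proof (cases n)
    case (Suc m)
    have "fps_nth (fps_X * (?G * NC_sum_fps w)) n = fps_nth (?G * NC_sum_fps w) m"
      using Suc by simp
    then show ?thesis
      using Suc by (simp add: fps_mult_nth NC_sum_fps_def atLeast0AtMost lessThan_Suc_atMost)
  qed simp
  finally show "fps_nth (Abs_fps (rooted_NC_sum u w)) n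
      = fps_nth (fps_const (u 1) * NC_sum_fps w + fps_X * (?G * NC_sum_fps w)) n"
    using rooted_NC_sum_rec[of u w n] by (simp add: NC_sum_fps_def)
qed

text \<open>The recursion is unrolled N times. The extra factor \<open>fps_X\<close> pairs every
  \<open>M\<close> with its own \<open>fps_X\<close> and makes the remainder divisible by
  \<open>fps_X ^ Suc N\<close>.\<close>

lemma rooted_NC_sum_fps_expand:
  fixes u w :: "nat \<Rightarrow> 'a::comm_ring_1"
  defines "M \<equiv> NC_sum_fps w"
  shows "fps_X * Abs_fps (rooted_NC_sum u w) = (\<Sum>i<N. fps_const (u (Suc i)) * (fps_X * M) ^ Suc i)
    + fps_X ^ Suc N * (M ^ N * Abs_fps (rooted_NC_sum (\<lambda>k. u (k + N)) w))"
proof (induction N)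
  case (Suc N)
  have "Abs_fps (rooted_NC_sum (\<lambda>k. u (k + N)) w) = fps_const (u (Suc N)) * M
      + fps_X * (Abs_fps (rooted_NC_sum (\<lambda>k. u (k + Suc N)) w) * M)"
    using rooted_NC_sum_fps_rec[of "\<lambda>k. u (k + N)" w] by (simp add: M_def)
  then have "fps_X ^ Suc N * (M ^ N * Abs_fps (rooted_NC_sum (\<lambda>k. u (k + N)) w))
      = fps_const (u (Suc N)) * (fps_X * M) ^ Suc N
        + fps_X ^ Suc (Suc N) * (M ^ Suc N * Abs_fps (rooted_NC_sum (\<lambda>k. u (k + Suc N)) w))"
    by (simp only: distrib_left power_Suc power_mult_distrib mult_ac)
  then show ?case
    unfolding Suc.IH by (simp only: sum.lessThan_Suc add.assoc)
qed simp

theorem NC_sum_fps_eq: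
  fixes w :: "nat \<Rightarrow> 'a::comm_ring_1"
  shows "NC_sum_fps w - 1 = fps_compose (Abs_fps (\<lambda>n. if n = 0 then 0 else w n)) (fps_X * NC_sum_fps w)"
proof (rule fps_ext)
  fix n
  let ?M = "NC_sum_fps w" and ?r = "Abs_fps (\<lambda>n. if n = 0 then 0 else w n)"
  \<comment> \<open>For n > 0 the points \<open>{1..n}\<close> are renumbered as
    \<open>{..n - 1}\<close>, where giving the root the same weights as the other blocks recovers
    the full sum.\<close>
  have M: "?M = 1 + fps_X * Abs_fps (rooted_NC_sum w w)"
  proof (rule fps_ext)
    fix n
    show "fps_nth ?M n = fps_nth (1 + fps_X * Abs_fps (rooted_NC_sum w w)) n"
    proof (cases n)
      case 0
      then show ?thesis by (simp add: NC_sum_fps_def NC_sum_def NC_on_empty)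
    next
      case (Suc m)
      then have "NC_sum w {1..n} = NC_sum w {..m}"
        by (intro NC_sum_card_cong) auto
      then show ?thesis using Suc by (simp add: NC_sum_fps_def NC_sum_atMost)
    qed
  qed
  have "?M - 1 = fps_X * Abs_fps (rooted_NC_sum w w)"
    by (subst M) simp
  also have "\<dots> = (\<Sum>i<n. fps_const (w (Suc i)) * (fps_X * ?M) ^ Suc i)
      + fps_X ^ Suc n * (?M ^ n * Abs_fps (rooted_NC_sum (\<lambda>k. w (k + n)) w))"
    by (rule rooted_NC_sum_fps_expand)
  \<comment> \<open>Expanding to depth n suffices for coefficient n: the remainder is divisible by
    \<open>fps_X ^ Suc n\<close>.\<close>
  finally have "fps_nth (?M - 1) n = (\<Sum>i<n. w (Suc i) * fps_nth ((fps_X * ?M) ^ Suc i) n)"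
    by (simp add: fps_sum_nth fps_X_power_mult_nth del: power_Suc fps_sub_nth)
  \<comment> \<open>The added term i = 0 vanishes because \<open>?r\<close> has no constant
    coefficient.\<close>
  also have "\<dots> = (\<Sum>i=0..n. fps_nth ?r i * fps_nth ((fps_X * ?M) ^ i) n)"
    by (simp add: atLeast0AtMost sum.atMost_shift del: power_Suc)
  also have "\<dots> = fps_nth (fps_compose ?r (fps_X * ?M)) n"
    by (simp add: fps_compose_nth)
  finally show "fps_nth (?M - 1) n = fps_nth (fps_compose ?r (fps_X * ?M)) n" .
qed


section \<open>Moments and cumulants\<close>

lemma subtuple_replicate:
  assumes "V \<subseteq> {1..n}"
  shows "subtuple (replicate n x) V = replicate (card V) x"
proof (rule replicate_eqI)
  fix y assume "y \<in> set (subtuple (replicate n x) V)"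
  moreover have "finite V" using assms by (rule finite_subset) simp
  ultimately obtain v where "v \<in> V" "y = replicate n x ! (v - 1)"
    by (auto simp: subtuple_def)
  moreover have "v \<in> {1..n}" using assms \<open>v \<in> V\<close> by blast
  then have "v - 1 < n" by auto
  ultimately show "y = x" by simp
qed simp

text \<open>Subtuples of a constant tuple are constant, so a block enters the moment-cumulant
  formula through its size alone.\<close>

lemma moment_eq_NC_sum:
  assumes "n > 0"
  shows "\<phi> (x ^ n) = NC_sum (\<lambda>k. free_cumulant \<phi> (replicate k x)) {1..n}"
proof -
  have "\<phi> (x ^ n) = (\<Sum>\<pi>\<in>NC n. \<Prod>V\<in>\<pi>. free_cumulant \<phi> (subtuple (replicate n x) V))"
    using moment_cumulant[of "replicate n x" \<phi>] assms by simp
  also have "\<dots> = (\<Sum>\<pi>\<in>NC n. \<Prod>V\<in>\<pi>. free_cumulant \<phi> (replicate (card V) x))"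
    by (intro sum.cong prod.cong refl) (metis NC_eq_NC_on NC_onD(6) subtuple_replicate)
  finally show ?thesis by (simp add: NC_sum_def NC_eq_NC_on)
qed

lemma NC_block_card:
  assumes "\<pi> \<in> NC n" "V \<in> \<pi>"
  shows "finite V" "card V > 0"
proof -
  have "V \<subseteq> {1..n}" "V \<noteq> {}"
    using NC_onD(2,6)[OF assms(1)[unfolded NC_eq_NC_on]] assms(2) by blast+
  then show "finite V" by (auto intro: finite_subset)
  then show "card V > 0" using \<open>V \<noteq> {}\<close> by (simp add: card_gt_0_iff)
qed

text \<open>Moebius inversion is applied to block products of moments and of cumulants; at the
  one-block partition the latter product is a single cumulant.\<close>

lemma free_cumulant_eq_moebius_sum:
  assumes "n > 0"
  shows "free_cumulant \<phi> (replicate n x) =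
    (\<Sum>\<pi>\<in>NC n. (\<Prod>V\<in>\<pi>. \<phi> (x ^ card V)) * of_int (NC_moebius n \<pi> (NC_top n)))"
proof -
  let ?w = "\<lambda>k. free_cumulant \<phi> (replicate k x)"
  have "(\<Sum>\<sigma> | \<sigma> \<in> NC n \<and> NC_le n \<sigma> (NC_top n).
        (\<Prod>V\<in>\<sigma>. \<phi> (x ^ card V)) * of_int (NC_moebius n \<sigma> (NC_top n)))
      = (\<Prod>V\<in>NC_top n. ?w (card V))"
  proof (rule NC_moebius_inversion)
    fix \<sigma> assume \<sigma>: "\<sigma> \<in> NC n"
    \<comment> \<open>Each moment is expanded over partitions of the block \<open>V\<close> itself
      instead of \<open>{1..card V}\<close>, as \<open>prod_NC_sum\<close> requires.\<close>
    have "(\<Prod>V\<in>\<sigma>. \<phi> (x ^ card V)) = (\<Prod>V\<in>\<sigma>. NC_sum ?w V)"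
    proof (intro prod.cong refl)
      fix V assume "V \<in> \<sigma>"
      note V = NC_block_card[OF \<sigma> this]
      show "\<phi> (x ^ card V) = NC_sum ?w V"
        unfolding moment_eq_NC_sum[OF V(2)] using V(1) by (intro NC_sum_card_cong) auto
    qed
    also have "\<dots> = (\<Sum>\<pi> | \<pi> \<in> NC n \<and> NC_le n \<pi> \<sigma>. \<Prod>V\<in>\<pi>. ?w (card V))"
      using \<sigma> by (rule prod_NC_sum)
    finally show "(\<Prod>V\<in>\<sigma>. \<phi> (x ^ card V)) = \<dots>" .
  qed (use assms in \<open>rule NC_top_in_NC\<close>)
  moreover have "{\<sigma>. \<sigma> \<in> NC n \<and> NC_le n \<sigma> (NC_top n)} = NC n"
    using NC_le_top[OF assms] by blast
  moreover have "(\<Prod>V\<in>NC_top n. ?w (card V)) = ?w n"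
    by (simp add: NC_top_def)
  ultimately show ?thesis by simp
qed

theorem proposition2p2:
  fixes scale :: "complex \<Rightarrow> 'a::ring_1 \<Rightarrow> 'a"
    and \<phi> :: "'a \<Rightarrow> complex"
    and B :: "'a set"
    and E :: "'a \<Rightarrow> 'a"
    and x :: 'a
  assumes "nc_prob_space scale \<phi>"
    and "nc_prob_space_over scale B E"
    and "compatible \<phi> E"
  shows "R_transform \<phi> x =
      Abs_fps (\<lambda>n. if n = 0 then 0 else
        (\<Sum>\<pi>\<in>NC n. (\<Prod>V\<in>\<pi>. \<phi> (fps_nth (B_moment_series E x) (card V)))
                    * of_int (NC_moebius n \<pi> (NC_top n))))
    \<and> moment_series \<phi> x =
      Abs_fps (\<lambda>n. if n = 0 then 0 else
        (\<Sum>\<pi>\<in>NC n. \<Prod>V\<in>\<pi>.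
           (\<Sum>\<theta>\<in>NC (card V).
              (\<Prod>W\<in>\<theta>. \<phi> (fps_nth (B_moment_series E x) (card W)))
              * of_int (NC_moebius (card V) \<theta> (NC_top (card V))))))
    \<and> moment_series \<phi> x =
      fps_compose (R_transform \<phi> x) (fps_X * (1 + moment_series \<phi> x))"
proof -
  let ?w = "\<lambda>k. free_cumulant \<phi> (replicate k x)"
  \<comment> \<open>The constant coefficient of \<open>B_moment_series\<close> is set to 0, so k
    must be positive; block sizes always are.\<close>
  have \<phi>E: "\<phi> (fps_nth (B_moment_series E x) k) = \<phi> (x ^ k)" if "k > 0" for k
    using assms(3) that by (simp add: B_moment_series_def compatible_def)
  have cumulant: "(\<Sum>\<pi>\<in>NC n. (\<Prod>V\<in>\<pi>. \<phi> (fps_nth (B_moment_series E x) (card V)))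
      * of_int (NC_moebius n \<pi> (NC_top n))) = ?w n" if "n > 0" for n
  proof -
    have "(\<Prod>V\<in>\<pi>. \<phi> (fps_nth (B_moment_series E x) (card V))) = (\<Prod>V\<in>\<pi>. \<phi> (x ^ card V))"
      if "\<pi> \<in> NC n" for \<pi>
      by (intro prod.cong refl \<phi>E NC_block_card[OF that])
    then show ?thesis
      unfolding free_cumulant_eq_moebius_sum[OF that] by (intro sum.cong refl) simp
  qed
  have "R_transform \<phi> x =
      Abs_fps (\<lambda>n. if n = 0 then 0 else
        (\<Sum>\<pi>\<in>NC n. (\<Prod>V\<in>\<pi>. \<phi> (fps_nth (B_moment_series E x) (card V)))
                    * of_int (NC_moebius n \<pi> (NC_top n))))"
    by (rule fps_ext) (simp add: R_transform_def cumulant)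
  moreover have "moment_series \<phi> x =
      Abs_fps (\<lambda>n. if n = 0 then 0 else
        (\<Sum>\<pi>\<in>NC n. \<Prod>V\<in>\<pi>.
           (\<Sum>\<theta>\<in>NC (card V).
              (\<Prod>W\<in>\<theta>. \<phi> (fps_nth (B_moment_series E x) (card W)))
              * of_int (NC_moebius (card V) \<theta> (NC_top (card V))))))"
  proof (rule fps_ext)
    fix n
    \<comment> \<open>By \<open>cumulant\<close> each inner sum is the cumulant of order
      \<open>card V\<close>, which leaves the moment-cumulant formula.\<close>
    have "(\<Sum>\<pi>\<in>NC n. \<Prod>V\<in>\<pi>.
           (\<Sum>\<theta>\<in>NC (card V).
              (\<Prod>W\<in>\<theta>. \<phi> (fps_nth (B_moment_series E x) (card W)))
              * of_int (NC_moebius (card V) \<theta> (NC_top (card V)))))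
        = NC_sum ?w {1..n}"
      unfolding NC_sum_def NC_eq_NC_on[symmetric]
      by (intro sum.cong prod.cong refl cumulant NC_block_card)
    then show "fps_nth (moment_series \<phi> x) n = fps_nth (Abs_fps (\<lambda>n. if n = 0 then 0 else
        (\<Sum>\<pi>\<in>NC n. \<Prod>V\<in>\<pi>.
           (\<Sum>\<theta>\<in>NC (card V).
              (\<Prod>W\<in>\<theta>. \<phi> (fps_nth (B_moment_series E x) (card W)))
              * of_int (NC_moebius (card V) \<theta> (NC_top (card V))))))) n"
      by (simp add: moment_series_def moment_eq_NC_sum del: One_nat_def)
  qed
  \<comment> \<open>The summand 1 supplies the constant coefficient, so \<open>NC_sum_fps_eq\<close>
    becomes the functional equation.\<close>
  moreover have "1 + moment_series \<phi> x = NC_sum_fps ?w"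
  proof (rule fps_ext)
    show "fps_nth (1 + moment_series \<phi> x) n = fps_nth (NC_sum_fps ?w) n" for n
      by (cases "n = 0")
        (simp_all add: moment_series_def NC_sum_fps_def moment_eq_NC_sum NC_sum_def NC_on_empty
          del: One_nat_def)
  qed
  then have "moment_series \<phi> x = fps_compose (R_transform \<phi> x) (fps_X * (1 + moment_series \<phi> x))"
    using NC_sum_fps_eq[of ?w] unfolding R_transform_def by (metis add_diff_cancel_left')
  ultimately show ?thesis by blast
qed

end
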